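(* For every integer $n \ge 2$, we have $$(n^2 - 4n + 3) M_1^{(2)}(n) - 24 M_2^{(2)}(n) \begin{cases} =0 & \text{if } n \text{ is an odd prime},\\ <0 & \text{if } n = 2^l \text{ for some } l \in \mathbb{Z}_{\ge 1},\\ >0 & \text{otherwise,}\end{cases}$$ and $$(n^4 - n^3 - 14n^2 + 29n - 15) M_1^{(2)}(n) - 120(3n-8) M_2^{(2)}(n) - 5760 M_3^{(2)}(n) \begin{cases} =0 & \text{if } n \text{ is an odd prime},\\ <0 & \text{if } n = 2^l \text{ for some } l \in \mathbb{Z}_{\ge 1},\\ >0 & \text{otherwise.}\end{cases}$$
   Context: For each positive integer $k$, the numbers $M_k^{(2)}(n)$ ($n \ge 1$) are defined as the coefficients of the $q$-series $$\sum_{n=1}^\infty M_k^{(2)}(n) q^n := \sum_{\substack{0 < m_1 < m_2 < \cdots < m_k \\ m_i \text{ odd } (1 \le i \le k)}} \frac{q^{m_1 + m_2 + \cdots + m_k}}{(1-q^{m_1})^2 (1-q^{m_2})^2 \cdots (1- q^{m_k})^2},$$ where the sum is over strictly increasing $k$-tuples of positive odd integers. *)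

theory Defs
  imports "HOL-Analysis.Analysis" "HOL-Computational_Algebra.Computational_Algebra"
begin

text \<open>Strictly increasing \<open>k\<close>-tuples \<open>0 < m\<^sub>1 < \<dots> < m\<^sub>k\<close> of odd integers are represented as lists.\<close>

definition odd_tuples :: "nat \<Rightarrow> nat list set" where
  "odd_tuples k = {ms. length ms = k \<and> sorted_wrt (<) ms \<and> (\<forall>m \<in> set ms. odd m)}"

definition M2_summand :: "nat list \<Rightarrow> real fps" where
  "M2_summand ms = fps_X ^ sum_list ms / (\<Prod>m\<leftarrow>ms. (1 - fps_X ^ m)\<^sup>2)"

text \<open>The infinite sum is an unordered sum with respect to the \<open>q\<close>-adic topology of the library
  on formal power series in \<open>q =\<close> \<^term>\<open>fps_X\<close>; it converges by \<open>M2_gf_has_sum\<close> below.\<close>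

definition M2_gf :: "nat \<Rightarrow> real fps" where
  "M2_gf k = (\<Sum>\<^sub>\<infinity>ms \<in> odd_tuples k. M2_summand ms)"

definition M2 :: "nat \<Rightarrow> nat \<Rightarrow> real" where
  "M2 k n = fps_nth (M2_gf k) n"

lemma M2_summand_nth_eq_0:
  assumes "ms \<in> odd_tuples k" "n < sum_list ms"
  shows "fps_nth (M2_summand ms) n = 0"
proof -
  define D where "D = (\<Prod>m\<leftarrow>ms. (1 - fps_X ^ m :: real fps)\<^sup>2)"
  have "fps_nth (\<Prod>m\<leftarrow>ms'. (1 - fps_X ^ m :: real fps)\<^sup>2) 0 = 1"
    if "\<forall>m \<in> set ms'. odd m" for ms'
    using that by (induction ms') (auto simp: fps_mult_nth power2_eq_square odd_pos)
  then have "fps_nth D 0 \<noteq> 0"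
    using assms(1) by (auto simp: D_def odd_tuples_def)
  then have "M2_summand ms = fps_X ^ sum_list ms * inverse D"
    by (simp add: M2_summand_def D_def fps_divide_unit)
  then show ?thesis
    using assms(2) by (simp add: fps_X_power_mult_nth)
qed

lemma finite_odd_tuples_le: "finite {ms \<in> odd_tuples k. sum_list ms \<le> n}"
proof (rule finite_subset)
  show "{ms \<in> odd_tuples k. sum_list ms \<le> n} \<subseteq> {ms. set ms \<subseteq> {..n} \<and> length ms = k}"
    using member_le_sum_list by (fastforce simp: odd_tuples_def)
qed (simp add: finite_lists_length_eq)

lemma M2_summand_has_sum:
  "(M2_summand has_sum
     Abs_fps (\<lambda>n. \<Sum>ms | ms \<in> odd_tuples k \<and> sum_list ms \<le> n. fps_nth (M2_summand ms) n))
   (odd_tuples k)"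
  unfolding has_sum_def
proof (rule tendsto_fpsI)
  fix n
  let ?T = "{ms \<in> odd_tuples k. sum_list ms \<le> n}"
  have "fps_nth (sum M2_summand F) n = (\<Sum>ms\<in>?T. fps_nth (M2_summand ms) n)"
    if "finite F" "?T \<subseteq> F" "F \<subseteq> odd_tuples k" for F
    unfolding fps_sum_nth
    using that by (intro sum.mono_neutral_right) (auto intro!: M2_summand_nth_eq_0)
  then show "\<forall>\<^sub>F F in finite_subsets_at_top (odd_tuples k). fps_nth (sum M2_summand F) n =
      fps_nth (Abs_fps (\<lambda>n. \<Sum>ms | ms \<in> odd_tuples k \<and> sum_list ms \<le> n.
        fps_nth (M2_summand ms) n)) n"
    unfolding eventually_finite_subsets_at_top
    by (intro exI[of _ ?T]) (auto simp: finite_odd_tuples_le)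
qed

lemma M2_gf_has_sum: "(M2_summand has_sum M2_gf k) (odd_tuples k)"
  unfolding M2_gf_def using M2_summand_has_sum has_sum_infsum summable_on_def by blast

lemma M2_eq_sum:
  "M2 k n = (\<Sum>ms | ms \<in> odd_tuples k \<and> sum_list ms \<le> n. fps_nth (M2_summand ms) n)"
  by (simp add: M2_def M2_gf_def infsumI[OF M2_summand_has_sum])

end

theory Submission
  imports Defs
begin

text \<open>
  Write \<open>x\<^sub>m = q^m / (1 - q^m)^2\<close> for odd \<open>m\<close>. The \<open>k\<close>-th generating function is the elementary
  symmetric function \<open>e\<^sub>k\<close> of the \<open>x\<^sub>m\<close>. Put \<open>y = 2 - x - 1/x\<close>. Since
  \<open>(1 - q^m)^2 (1 + x\<^sub>m y) = (1 - x q^m)(1 - q^m / x)\<close>, the series \<open>\<Sum>k. e\<^sub>k y^k\<close> is, up to a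
  factor that does not involve \<open>x\<close>, the theta product. So the Jacobi triple product turns it into
  \<open>C * (\<Sum>j. (-1)^j q^(j^2) x^j)\<close>, where \<open>j\<close> runs over the integers and \<open>C\<close> is free of \<open>x\<close>. Comparing coefficients of \<open>x^j\<close> gives
  \<open>\<Sum>k. ((2k) choose (k + j)) e\<^sub>k = C q^(j^2)\<close>. Only the ratios of neighbouring
  coefficients matter, and they come from a finite version of the triple product
  (\<open>finite_jacobi\<close>, \<open>theta_coeff_lim_Suc\<close>), so that \<open>C\<close> never has to be identified.

  Let \<open>D = q d/dq\<close>. The theta series satisfies the heat equation \<open>D = (x d/dx)^2\<close>, and on powers of
  \<open>y\<close> one has \<open>(x d/dx)^2 (y^k) = k^2 y^k - 2k(2k - 1) y^(k-1)\<close>. This yields the recurrence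
  (\<open>M2_gf_recurrence\<close>)
  \<open>D e\<^sub>k = 2 e\<^sub>1 e\<^sub>k + k^2 e\<^sub>k - (2k + 2)(2k + 1) e\<^sub>k\<^sub>+\<^sub>1\<close>.
  So derivatives of \<open>e\<^sub>1\<close> and \<open>e\<^sub>2\<close> are polynomials in \<open>e\<^sub>1\<close>, \<open>e\<^sub>2\<close>, \<open>e\<^sub>3\<close>.

  On the other hand let \<open>s\<^sub>r(n)\<close> be the sum of \<open>j^r\<close> over the divisors \<open>j\<close> of \<open>n\<close> with \<open>n / j\<close> odd.
  Its generating series for \<open>r = 1, 3, 5\<close> is a linear combination of the power sums of the
  \<open>x\<^sub>m\<close>, hence by Newton's identities a polynomial in \<open>e\<^sub>1\<close>, \<open>e\<^sub>2\<close>, \<open>e\<^sub>3\<close>. Eliminating the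
  nonlinear terms shows that the two expressions of the theorem equal
  \<open>(n^2 - n + 1) s\<^sub>1(n) - s\<^sub>3(n)\<close> and \<open>(n^4 - n^3 + n^2 - n + 1) s\<^sub>1(n) - s\<^sub>5(n)\<close>
  (\<open>M2_quadratic_combination\<close>, \<open>M2_quartic_combination\<close>).

  With \<open>k = 2\<close> or \<open>k = 4\<close>, either of these times \<open>n + 1\<close> is the sum of
  \<open>j (n^(k+1) + 1 - (n + 1) j^k)\<close> over the same divisors \<open>j\<close>. The divisors \<open>j = n\<close> and \<open>j = 1\<close>
  contribute opposite values, negative for \<open>j = n\<close>, and all others contribute positive values. This
  gives zero at odd primes, a positive value at odd composite numbers, and a negative value at powers
  of two, where only \<open>j = n\<close> occurs. If \<open>n\<close> is even but no power of two, then \<open>j = 1\<close> does not occur,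
  but some even \<open>j \<le> n / 3\<close> does, and its contribution alone outweighs the negative one
  (\<open>sign_trichotomy\<close>).
\<close>

section \<open>Elementary symmetric polynomials and Newton's identities\<close>

fun esym :: "(nat \<Rightarrow> 'a :: comm_ring_1) \<Rightarrow> nat \<Rightarrow> nat \<Rightarrow> 'a" where
  "esym x N 0 = 1"
| "esym x 0 (Suc k) = 0"
| "esym x (Suc N) (Suc k) = esym x N (Suc k) + x N * esym x N k"

lemma esym_eq_0: "N < k \<Longrightarrow> esym x N k = 0"
  by (induction x N k rule: esym.induct) auto

text \<open>
  Newton's identities in degrees two and three. Induction on the number of variables proves them
  at once, because adjoining a variable changes both sides by the same polynomial.
\<close>
lemma power_sum_2_esym: "(\<Sum>i<N. x i ^ 2) = esym x N 1 ^ 2 - 2 * esym x N 2"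
  by (induction N) (auto simp: numeral_eq_Suc algebra_simps)

lemma power_sum_3_esym:
  "(\<Sum>i<N. x i ^ 3) = esym x N 1 ^ 3 - 3 * esym x N 1 * esym x N 2 + 3 * esym x N 3"
proof (induction N)
  case (Suc N)
  have "esym x (Suc N) 1 = esym x N 1 + x N" "esym x (Suc N) 2 = esym x N 2 + x N * esym x N 1"
    "esym x (Suc N) 3 = esym x N 3 + x N * esym x N 2"
    by (auto simp: numeral_eq_Suc)
  then show ?case unfolding sum.lessThan_Suc Suc.IH
    by (simp add: algebra_simps power2_eq_square power3_eq_cube)
qed (auto simp: numeral_eq_Suc)

section \<open>The generating functions as elementary symmetric functions\<close>

definition x_term :: "nat \<Rightarrow> real fps" where
  "x_term m = fps_X ^ m / (1 - fps_X ^ m)\<^sup>2"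

lemma one_minus_X_power_unit:
  "m > 0 \<Longrightarrow> fps_nth ((1 - fps_X ^ m :: real fps) ^ 2) 0 = 1"
  by (simp add: power2_eq_square)

lemma x_term_eq: "m > 0 \<Longrightarrow> (1 - fps_X ^ m)\<^sup>2 * x_term m = fps_X ^ m"
  using one_minus_X_power_unit[of m]
  by (simp add: x_term_def fps_divide_unit mult.left_commute inverse_mult_eq_1')

lemma M2_summand_eq_prod: 
  assumes "\<forall>m\<in>set ms. m > 0"
  shows "M2_summand ms = (\<Prod>m\<leftarrow>ms. x_term m)"
  using assms
proof (induction ms)
  case (Cons m ms)
  define D where "D = (\<Prod>m\<leftarrow>ms. (1 - fps_X ^ m :: real fps)\<^sup>2)"
  have D: "fps_nth D 0 = 1" using Cons.prems unfolding D_def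
    by (induction ms) (auto simp: one_minus_X_power_unit)
  have m: "fps_nth ((1 - fps_X ^ m :: real fps) ^ 2) 0 = 1"
    using Cons.prems by (intro one_minus_X_power_unit) auto
  have "M2_summand (m # ms) = fps_X ^ m * fps_X ^ sum_list ms * inverse ((1 - fps_X ^ m)\<^sup>2 * D)"
    using D m by (simp add: M2_summand_def D_def[symmetric] fps_divide_unit power_add)
  also have "\<dots> = x_term m * M2_summand ms"
    using D m by (simp add: x_term_def M2_summand_def D_def[symmetric] fps_divide_unit fps_inverse_mult)
  finally show ?case using Cons by simp
qed (simp add: M2_summand_def)

definition odd_tuples_below :: "nat \<Rightarrow> nat \<Rightarrow> nat list set" where
  "odd_tuples_below N k = {ms \<in> odd_tuples k. \<forall>m\<in>set ms. m < 2 * N}"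

lemma finite_odd_tuples_below: "finite (odd_tuples_below N k)"
proof (rule finite_subset)
  show "odd_tuples_below N k \<subseteq> {ms. set ms \<subseteq> {..<2*N} \<and> length ms = k}"
    by (auto simp: odd_tuples_below_def odd_tuples_def)
qed (simp add: finite_lists_length_eq)

text \<open>
  The only odd number in \<open>{2 * N..<2 * N + 2}\<close> is \<open>2 * N + 1\<close>, and it can only be the last entry of
  an increasing list. This split matches the recursion of elementary symmetric polynomials.
\<close>
lemma odd_tuples_below_Suc:
  "odd_tuples_below (Suc N) (Suc k) =
     odd_tuples_below N (Suc k) \<union> (\<lambda>ms. ms @ [2 * N + 1]) ` odd_tuples_below N k"
proof (intro equalityI subsetI)
  fix ms assume ms: "ms \<in> odd_tuples_below (Suc N) (Suc k)"
  then obtain ms' l where l: "ms = ms' @ [l]"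
    by (cases ms rule: rev_cases) (auto simp: odd_tuples_below_def odd_tuples_def)
  have "odd l" "l < 2 * N + 2" and 1: "\<forall>m\<in>set ms'. m < l \<and> odd m" "sorted_wrt (<) ms'" "length ms' = k"
    using ms l by (auto simp: odd_tuples_below_def odd_tuples_def sorted_wrt_append)
  then have "l = 2 * N + 1 \<or> l < 2 * N" by presburger
  then show "ms \<in> odd_tuples_below N (Suc k) \<union> (\<lambda>ms. ms @ [2 * N + 1]) ` odd_tuples_below N k"
  proof
    assume "l = 2 * N + 1"
    moreover have "m < 2 * N" if "m \<in> set ms'" for m 
    proof -
      have "m < 2 * N + 1" "odd m" using 1 that \<open>l = _\<close> by auto
      then show ?thesis by presburger
    qed
    ultimately show ?thesis using 1 l by (auto simp: odd_tuples_below_def odd_tuples_def)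
  next
    assume "l < 2 * N"
    then show ?thesis using 1 l ms by (auto simp: odd_tuples_below_def odd_tuples_def)
  qed
qed (auto simp: odd_tuples_below_def odd_tuples_def sorted_wrt_append; meson less_SucI)+

definition x_odd :: "nat \<Rightarrow> real fps" where
  "x_odd i = x_term (2 * i + 1)"

lemma esym_eq_sum_tuples:
  "esym x_odd N k = (\<Sum>ms\<in>odd_tuples_below N k. M2_summand ms)"
proof (induction x_odd N k rule: esym.induct)
  case (1 N)
  have "odd_tuples_below N 0 = {[]}" by (auto simp: odd_tuples_below_def odd_tuples_def)
  then show ?case by (simp add: M2_summand_def)
next
  case (2 k)
  have "odd_tuples_below 0 (Suc k) = {}"
    by (auto simp: odd_tuples_below_def odd_tuples_def length_Suc_conv)
  then show ?case by simp
next
  case (3 N k)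
  have "inj_on (\<lambda>ms. ms @ [2 * N + 1]) (odd_tuples_below N k)" by (auto simp: inj_on_def)
  moreover have "M2_summand (ms @ [2 * N + 1]) = x_odd N * M2_summand ms"
    if "ms \<in> odd_tuples_below N k" for ms
    using that odd_pos
    by (subst (1 2) M2_summand_eq_prod) (auto simp: odd_tuples_below_def odd_tuples_def x_odd_def mult.commute)
  ultimately have "(\<Sum>ms\<in>(\<lambda>ms. ms @ [2 * N + 1]) ` odd_tuples_below N k. M2_summand ms) 
      = x_odd N * (\<Sum>ms\<in>odd_tuples_below N k. M2_summand ms)"
    by (simp add: sum.reindex sum_distrib_left)
  moreover have "odd_tuples_below N (Suc k) \<inter> (\<lambda>ms. ms @ [2 * N + 1]) ` odd_tuples_below N k = {}"
    by (auto simp: odd_tuples_below_def)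
  ultimately show ?case using 3
    by (simp add: odd_tuples_below_Suc sum.union_disjoint finite_odd_tuples_below)
qed

text \<open>
  Tuples with an entry above \<open>n\<close> contribute nothing to the coefficient of \<open>q^n\<close>, so the infinite
  sum may be replaced by an elementary symmetric polynomial in finitely many variables.
\<close>
lemma M2_eq_esym:
  assumes "n \<le> 2 * N"
  shows "M2 k n = fps_nth (esym x_odd N k) n"
proof -
  have "m < 2 * N" if "ms \<in> odd_tuples k" "sum_list ms \<le> n" "m \<in> set ms" for ms m
  proof -
    have "m \<le> 2 * N" "odd m" using that assms member_le_sum_list[of m ms] by (auto simp: odd_tuples_def)
    then show ?thesis by presburger
  qed
  then show ?thesis
    unfolding M2_eq_sum esym_eq_sum_tuples fps_sum_nth
    by (intro sum.mono_neutral_left finite_odd_tuples_below)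
      (auto simp: odd_tuples_below_def intro!: M2_summand_nth_eq_0)
qed

lemma M2_eq_0: 
  assumes "n < k" 
  shows "M2 k n = 0"
proof -
  have "esym x_odd n k = 0" using assms by (rule esym_eq_0)
  then show ?thesis using M2_eq_esym[of n n k] by simp
qed

lemma M2_0: "M2 0 n = (if n = 0 then 1 else 0)"
  using M2_eq_esym[of n n 0] by simp

section \<open>A finite form of the Jacobi triple product\<close>

text \<open>
  The coefficient of \<open>x^j\<close> in \<open>(2 - x - 1/x)^k\<close> is \<open>(-1)^j\<close> times this number, which is why it
  links expansions in powers of \<open>y = 2 - x - 1/x\<close> with Laurent expansions in \<open>x\<close>.
\<close>
definition central_choose :: "nat \<Rightarrow> nat \<Rightarrow> nat" where
  "central_choose k j = (2 * k) choose (k + j)"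

lemma central_choose_eq_0: "k < j \<Longrightarrow> central_choose k j = 0"
  by (simp add: central_choose_def)

lemma central_choose_self [simp]: "central_choose k k = 1"
  by (simp add: central_choose_def flip: mult_2)

lemma central_choose_0_left: "central_choose 0 j = (if j = 0 then 1 else 0)"
  by (simp add: central_choose_def)

text \<open>
  Multiplication by \<open>x + 2 + 1/x\<close>, read on coefficients. At \<open>j = 0\<close> both neighbours of the
  coefficient agree by symmetry, hence the separate rule that follows.
\<close>
lemma central_choose_Suc_Suc:
  "central_choose (Suc k) (Suc j) =
     central_choose k j + 2 * central_choose k (Suc j) + central_choose k (Suc (Suc j))"
  by (simp add: central_choose_def)

lemma central_choose_Suc_0: "central_choose (Suc k) 0 = 2 * central_choose k 0 + 2 * central_choose k 1"
proof -
  have "(2 * k) choose (k - 1) = (2 * k) choose (k + 1)" if "k > 0"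
    using that binomial_symmetric[of "k - 1" "2 * k"] by (simp)
  then show ?thesis by (cases k) (simp_all add: central_choose_def)
qed

text \<open>
  This is the action of \<open>(x d/dx)^2\<close> on powers of \<open>y = 2 - x - 1/x\<close>, namely
  \<open>(x d/dx)^2 (y^k) = k^2 y^k - 2k(2k - 1) y^(k-1)\<close>, read on coefficients with \<open>k\<close> shifted by one.
\<close>
lemma central_choose_absorb:
  "j^2 * central_choose (Suc k) j + (2 * k + 2) * (2 * k + 1) * central_choose k j =
     (k + 1)^2 * central_choose (Suc k) j"
proof (cases "j \<le> k")
  case True
  then obtain i where k: "k = j + i" using le_Suc_ex by blast
  have 1: "fact (k + j) * (fact i * central_choose k j) = fact (2 * k)"
    using binomial_fact_lemma[of "k + j" "2 * k"] by (simp add: k central_choose_def mult.assoc)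
  have 2: "fact (k + j + 1) * (fact (i + 1) * central_choose (Suc k) j) = fact (2 * k + 2)"
    using binomial_fact_lemma[of "k + j + 1" "2 * k + 2"]
    by (simp add: k central_choose_def mult.assoc Suc_diff_le del: fact_Suc binomial_Suc_Suc)
  have "fact (k + j) * fact i * ((k + j + 1) * (i + 1) * central_choose (Suc k) j) =
        (2 * k + 2) * ((2 * k + 1) * fact (2 * k))"
    using 2 by (simp add: algebra_simps)
  also have "\<dots> = fact (k + j) * fact i * ((2 * k + 2) * (2 * k + 1) * central_choose k j)"
    unfolding 1[symmetric] by (simp add: algebra_simps)
  finally have "(k + j + 1) * (i + 1) * central_choose (Suc k) j = (2 * k + 2) * (2 * k + 1) * central_choose k j"
    by (subst (asm) mult_left_cancel) auto
  then have "j^2 * central_choose (Suc k) j + (2 * k + 2) * (2 * k + 1) * central_choose k j =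
      (j^2 + (k + j + 1) * (i + 1)) * central_choose (Suc k) j"
    by (simp add: distrib_right)
  also have "j^2 + (k + j + 1) * (i + 1) = (k + 1)^2"
    by (simp add: k algebra_simps power2_eq_square)
  finally show ?thesis .
next
  case False
  then show ?thesis by (cases "j = Suc k") (auto simp: central_choose_eq_0)
qed

text \<open>
  Up to the sign \<open>(-1)^j\<close>, the coefficient of \<open>x^j\<close> in the product of the factors
  \<open>1 + x\<^sub>i y\<close> over \<open>i < N\<close>, where \<open>y = 2 - x - 1/x\<close>.
\<close>
definition theta_coeff :: "(nat \<Rightarrow> 'a :: comm_ring_1) \<Rightarrow> nat \<Rightarrow> nat \<Rightarrow> 'a" where
  "theta_coeff x N j = (\<Sum>k\<le>N. of_nat (central_choose k j) * esym x N k)"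

lemma theta_coeff_0_left: "theta_coeff x 0 j = (if j = 0 then 1 else 0)"
  by (simp add: theta_coeff_def central_choose_0_left)

lemma theta_coeff_eq_0: "N < j \<Longrightarrow> theta_coeff x N j = 0"
  by (simp add: theta_coeff_def central_choose_eq_0)

lemma theta_coeff_Suc:
  "theta_coeff x (Suc N) j =
     theta_coeff x N j + x N * (\<Sum>k\<le>N. of_nat (central_choose (Suc k) j) * esym x N k)"
proof -
  have "theta_coeff x (Suc N) j = of_nat (central_choose 0 j)
       + (\<Sum>k\<le>N. of_nat (central_choose (Suc k) j) * esym x N (Suc k))
       + x N * (\<Sum>k\<le>N. of_nat (central_choose (Suc k) j) * esym x N k)"
    unfolding theta_coeff_def sum.atMost_Suc_shift by (simp add: algebra_simps sum.distrib sum_distrib_left)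
  also have "of_nat (central_choose 0 j) + (\<Sum>k\<le>N. of_nat (central_choose (Suc k) j) * esym x N (Suc k)) =
      (\<Sum>k\<le>Suc N. of_nat (central_choose k j) * esym x N k)"
    unfolding sum.atMost_Suc_shift by simp
  also have "\<dots> = theta_coeff x N j" by (simp add: theta_coeff_def esym_eq_0)
  finally show ?thesis .
qed

lemma theta_coeff_Suc_0:
  "theta_coeff x (Suc N) 0 =
     theta_coeff x N 0 + x N * (2 * theta_coeff x N 0 + 2 * theta_coeff x N 1)"
  unfolding theta_coeff_Suc
  by (simp add: theta_coeff_def central_choose_Suc_0 sum.distrib sum_distrib_left algebra_simps)

lemma theta_coeff_Suc_Suc:
  "theta_coeff x (Suc N) (Suc j) = theta_coeff x N (Suc j)
     + x N * (theta_coeff x N j + 2 * theta_coeff x N (Suc j) + theta_coeff x N (Suc (Suc j)))"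
  unfolding theta_coeff_Suc
  by (simp add: theta_coeff_def central_choose_Suc_Suc sum.distrib sum_distrib_left algebra_simps)

text \<open>
  The product \<open>(q^2; q^2)\<^sub>n\<close>.
\<close>
definition qpoch :: "'a :: comm_ring_1 \<Rightarrow> nat \<Rightarrow> 'a" where
  "qpoch q n = (\<Prod>i<n. 1 - q ^ (2 * i + 2))"

lemma qpoch_Suc: "qpoch q (Suc n) = qpoch q n * (1 - q ^ (2 * n + 2))"
  by (simp add: qpoch_def)

definition odd_qpoch_sq :: "'a :: comm_ring_1 \<Rightarrow> nat \<Rightarrow> 'a" where
  "odd_qpoch_sq q n = (\<Prod>i<n. (1 - q ^ (2 * i + 1)) ^ 2)"

text \<open>
  If \<open>x\<^sub>i = q^m / (1 - q^m)^2\<close> with \<open>m = 2i + 1\<close>, then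
  \<open>(1 - q^m)^2 (1 + x\<^sub>i y) = (1 - x q^m)(1 - q^m / x)\<close>, so the normalised product is a
  truncated theta product, and up to sign its coefficients are \<open>q^(j^2)\<close> times a Gaussian binomial
  coefficient in \<open>q^2\<close>. Denominators are cleared so that the identity makes sense in every commutative ring.
  In the induction step the new factor turns the coefficient \<open>c\<^sub>j\<close> into
  \<open>(1 + r^2) c\<^sub>j + r (c\<^sub>j\<^sub>-\<^sub>1 + c\<^sub>j\<^sub>+\<^sub>1)\<close> with \<open>r = q^(2N + 1)\<close>; after the induction
  hypothesis has been applied to the three terms, a polynomial identity remains.
\<close>
lemma finite_jacobi:
  fixes q :: "'a :: comm_ring_1"
  assumes x: "\<And>i. (1 - q ^ (2 * i + 1)) ^ 2 * x i = q ^ (2 * i + 1)"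
  assumes "j \<le> N"
  shows "odd_qpoch_sq q N * theta_coeff x N j * (qpoch q (N - j) * qpoch q (N + j)) =
     q ^ (j ^ 2) * qpoch q (2 * N)"
  using \<open>j \<le> N\<close>
proof (induction N arbitrary: j)
  case 0
  then show ?case by (simp add: odd_qpoch_sq_def theta_coeff_0_left qpoch_def)
next
  case (Suc N)
  define c where "c = (\<lambda>j. odd_qpoch_sq q N * theta_coeff x N j)"
  define r where "r = q ^ (2 * N + 1)"
  have W: "odd_qpoch_sq q (Suc N) = odd_qpoch_sq q N * (1 - r) ^ 2"
    by (simp add: odd_qpoch_sq_def r_def)
  have xN: "(1 - r) ^ 2 * x N = r" unfolding r_def by (rule x)
  have c0: "odd_qpoch_sq q (Suc N) * theta_coeff x (Suc N) 0 = (1 + r^2) * c 0 + 2 * r * c 1"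
  proof -
    have "odd_qpoch_sq q (Suc N) * theta_coeff x (Suc N) 0 =
      (1 - r)^2 * c 0 + ((1 - r)^2 * x N) * (2 * c 0 + 2 * c 1)"
      unfolding W theta_coeff_Suc_0 c_def by (simp add: algebra_simps)
    also have "\<dots> = (1 + r^2) * c 0 + 2 * r * c 1"
      unfolding xN by (simp add: algebra_simps power2_eq_square)
    finally show ?thesis .
  qed
  have cS: "odd_qpoch_sq q (Suc N) * theta_coeff x (Suc N) (Suc j) =
      (1 + r^2) * c (Suc j) + r * (c j + c (Suc (Suc j)))" for j
  proof -
    have "odd_qpoch_sq q (Suc N) * theta_coeff x (Suc N) (Suc j) =
      (1 - r)^2 * c (Suc j) + ((1 - r)^2 * x N) * (c j + 2 * c (Suc j) + c (Suc (Suc j)))"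
      unfolding W theta_coeff_Suc_Suc c_def by (simp add: algebra_simps)
    also have "\<dots> = (1 + r^2) * c (Suc j) + r * (c j + c (Suc (Suc j)))"
      unfolding xN by (simp add: algebra_simps power2_eq_square)
    finally show ?thesis .
  qed
  have IH: "c j * (qpoch q (N - j) * qpoch q (N + j)) = q ^ (j ^ 2) * qpoch q (2 * N)" if "j \<le> N" for j
    unfolding c_def by (rule Suc.IH) fact
  have c_0: "c j = 0" if "j > N" for j
    using that by (simp add: c_def theta_coeff_eq_0)
  have Q2: "qpoch q (2 * Suc N) = qpoch q (2 * N) * (1 - q ^ (4 * N + 2)) * (1 - q ^ (4 * N + 4))"
  proof -
    have "2 * Suc N = Suc (Suc (2 * N))" "2 * (2 * N) + 2 = 4 * N + 2" "2 * Suc (2 * N) + 2 = 4 * N + 4"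
      by simp_all
    then show ?thesis by (simp only: qpoch_Suc)
  qed
  \<comment> \<open>At \<open>j = Suc N\<close> the coefficient is \<open>0\<close>, and so is the factor \<open>1 - q ^ 0\<close> on the right.\<close>
  have mid: "c j * (qpoch q (Suc N - j) * qpoch q (Suc N + j)) =
     q ^ (j ^ 2) * qpoch q (2 * N) * ((1 - q ^ (2 * (Suc N - j))) * (1 - q ^ (2 * N + 2 * j + 2)))"
    if "j \<le> Suc N" for j
  proof (cases "j = Suc N")
    case False
    then have *: "Suc N - j = Suc (N - j)" "j \<le> N" using that by auto
    have "c j * (qpoch q (Suc N - j) * qpoch q (Suc N + j)) = c j * (qpoch q (N - j) * qpoch q (N + j)) *
        ((1 - q ^ (2 * (N - j) + 2)) * (1 - q ^ (2 * (N + j) + 2)))"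
      unfolding * add_Suc qpoch_Suc by (simp only: ac_simps)
    also have "2 * (N - j) + 2 = 2 * (Suc N - j)" using * by simp
    also have "2 * (N + j) + 2 = 2 * N + 2 * j + 2" by simp
    finally show ?thesis unfolding IH[OF *(2)] .
  qed (simp add: c_0)
  have low: "c j * (qpoch q (N - j) * qpoch q (Suc N + Suc j)) =
     q ^ (j ^ 2) * qpoch q (2 * N) * ((1 - q ^ (2 * N + 2 * j + 2)) * (1 - q ^ (2 * N + 2 * j + 4)))"
    if "j \<le> N" for j
  proof -
    have "c j * (qpoch q (N - j) * qpoch q (Suc N + Suc j)) = c j * (qpoch q (N - j) * qpoch q (N + j)) *
        ((1 - q ^ (2 * (N + j) + 2)) * (1 - q ^ (2 * Suc (N + j) + 2)))"
      by (simp only: add_Suc add_Suc_right qpoch_Suc ac_simps)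
    also have "2 * (N + j) + 2 = 2 * N + 2 * j + 2" by simp
    also have "2 * Suc (N + j) + 2 = 2 * N + 2 * j + 4" by simp
    finally show ?thesis unfolding IH[OF that] .
  qed
  have high: "c (Suc j) * (qpoch q (Suc N - j) * qpoch q (Suc N + j)) =
     q ^ (Suc j ^ 2) * qpoch q (2 * N) * ((1 - q ^ (2 * (N - j))) * (1 - q ^ (2 * (Suc N - j))))"
    if "j \<le> Suc N" for j
  proof (cases "j < N")
    case True
    then have *: "Suc N - j = Suc (Suc (N - Suc j))" "Suc N + j = N + Suc j" "Suc j \<le> N" by auto
    have "c (Suc j) * (qpoch q (Suc N - j) * qpoch q (Suc N + j)) =
        c (Suc j) * (qpoch q (N - Suc j) * qpoch q (N + Suc j)) *
        ((1 - q ^ (2 * (N - Suc j) + 2)) * (1 - q ^ (2 * Suc (N - Suc j) + 2)))"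
      unfolding *(1,2) qpoch_Suc by (simp only: ac_simps)
    also have "2 * (N - Suc j) + 2 = 2 * (N - j)" using * by simp
    also have "2 * Suc (N - Suc j) + 2 = 2 * (Suc N - j)" using * by simp
    finally show ?thesis unfolding IH[OF *(3)] .
  next
    case False
    then have "j = N \<or> j = Suc N" using that by auto
    then show ?thesis using c_0[of "Suc j"] by auto
  qed
  show ?case
  proof (cases j)
    case 0
    have "odd_qpoch_sq q (Suc N) * theta_coeff x (Suc N) 0 * (qpoch q (Suc N - 0) * qpoch q (Suc N + 0)) =
       (1 + r^2) * (c 0 * (qpoch q (Suc N - 0) * qpoch q (Suc N + 0)))
       + 2 * r * (c (Suc 0) * (qpoch q (Suc N - 0) * qpoch q (Suc N + 0)))"
      unfolding c0 by (simp add: algebra_simps)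
    also have "\<dots> = qpoch q (2 * N) * ((1 + r^2) * ((1 - q ^ (2 * N + 2)) * (1 - q ^ (2 * N + 2))) + 
        2 * r * q * ((1 - q ^ (2 * N)) * (1 - q ^ (2 * N + 2))))"
      by (subst mid, simp, subst high, simp) (simp add: algebra_simps)
    also have "\<dots> = qpoch q (2 * N) * ((1 - q ^ (4 * N + 2)) * (1 - q ^ (4 * N + 4)))"
    proof -
      define u where "u = q ^ (2 * N)"
      have u4: "q ^ (4 * N) = u ^ 2" by (simp add: u_def flip: power_mult)
      show ?thesis unfolding r_def power_add u4 u_def[symmetric] 
        by (simp add: algebra_simps power2_eq_square power4_eq_xxxx)
    qed
    finally show ?thesis unfolding Q2 using 0 by (simp add: mult.assoc)
  next
    case (Suc i)
    then obtain m where m: "N = i + m" using Suc.prems le_Suc_ex by auto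
    have iN: "i \<le> N" "Suc i \<le> Suc N" using m by auto
    define Q where "Q = qpoch q (Suc N - Suc i) * qpoch q (Suc N + Suc i)"
    define P where "P = q ^ (i ^ 2) * qpoch q (2 * N)"
    define v where "v = q ^ (2 * i)"
    define w where "w = q ^ (2 * m)"
    have r: "r = q * v * w"
      by (simp add: r_def m v_def w_def power_add distrib_left)
    have sq1: "q ^ (Suc i ^ 2) = q ^ (i ^ 2) * v * q"
    proof -
      have "Suc i ^ 2 = i ^ 2 + 2 * i + 1" by (simp add: power2_eq_square)
      then show ?thesis by (simp only: power_add power_one_right v_def)
    qed
    have sq2: "q ^ (Suc (Suc i) ^ 2) = q ^ (i ^ 2) * v ^ 2 * q ^ 4"
    proof -
      have "Suc (Suc i) ^ 2 = i ^ 2 + (2 * i + 2 * i) + 4" by (simp add: power2_eq_square)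
      then show ?thesis by (simp only: power_add v_def power2_eq_square[of "q ^ (2 * i)"])
    qed
    have mid': "c (Suc i) * Q = P * v * q * ((1 - w) * (1 - v^2 * w * q ^ 4))"
    proof -
      have "2 * N + 2 * Suc i + 2 = (2 * i + 2 * i) + 2 * m + 4" by (simp add: m)
      then have "q ^ (2 * N + 2 * Suc i + 2) = v ^ 2 * w * q ^ 4"
        by (simp only: power_add v_def w_def power2_eq_square[of "q ^ (2 * i)"])
      moreover have "q ^ (2 * (Suc N - Suc i)) = w" by (simp add: m w_def)
      ultimately have "c (Suc i) * Q =
          q ^ (i ^ 2) * v * q * qpoch q (2 * N) * ((1 - w) * (1 - v^2 * w * q ^ 4))"
        unfolding Q_def using mid[OF iN(2)] sq1 by (simp only:)
      then show ?thesis unfolding P_def by (simp only: ac_simps)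
    qed
    have low': "c i * Q = P * ((1 - v^2 * w * q ^ 2) * (1 - v^2 * w * q ^ 4))"
    proof -
      have "2 * N + 2 * i + 2 = (2 * i + 2 * i) + 2 * m + 2"
        "2 * N + 2 * i + 4 = (2 * i + 2 * i) + 2 * m + 4" by (simp_all add: m)
      then have "q ^ (2 * N + 2 * i + 2) = v^2 * w * q ^ 2" "q ^ (2 * N + 2 * i + 4) = v ^ 2 * w * q ^ 4"
        by (simp_all only: power_add v_def w_def power2_eq_square[of "q ^ (2 * i)"])
      then show ?thesis unfolding Q_def P_def using low[OF iN(1)] by (simp only: diff_Suc_Suc)
    qed
    have high': "c (Suc (Suc i)) * Q = P * v^2 * q^2 * ((q^2 - w) * (1 - w))"
    proof -
      have *: "q ^ (2 * (Suc N - Suc i)) = w" by (simp add: m w_def)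
      \<comment> \<open>For \<open>m = 0\<close> the subtraction truncates, but then \<open>1 - w = 0\<close>.\<close>
      have **: "q^2 * (1 - q ^ (2 * (N - Suc i))) * (1 - w) = (q^2 - w) * (1 - w)"
      proof (cases m)
        case (Suc p)
        then show ?thesis by (simp add: m w_def power_add algebra_simps power2_eq_square)
      qed (simp add: w_def)
      have "c (Suc (Suc i)) * Q = q ^ (i ^ 2) * v ^ 2 * q ^ 4 * qpoch q (2 * N) *
          ((1 - q ^ (2 * (N - Suc i))) * (1 - w))"
        unfolding Q_def using high[OF iN(2)] sq2 * by (simp only:)
      also have "q ^ 4 = q ^ 2 * q ^ 2" by (simp flip: power_add)
      finally have "c (Suc (Suc i)) * Q = P * v^2 * q^2 * (q^2 * (1 - q ^ (2 * (N - Suc i))) * (1 - w))"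
        unfolding P_def by (simp only: ac_simps)
      then show ?thesis unfolding ** .
    qed
    have "odd_qpoch_sq q (Suc N) * theta_coeff x (Suc N) (Suc i) * Q =
       (1 + r^2) * (c (Suc i) * Q) + r * (c i * Q) + r * (c (Suc (Suc i)) * Q)"
      unfolding cS by (simp add: algebra_simps)
    also have "\<dots> = P * v * q * ((1 - q^2 * v^2 * w^2) * (1 - q^4 * v^2 * w^2))"
      unfolding mid' low' high' r by (simp add: algebra_simps power2_eq_square power4_eq_xxxx)
    also have "\<dots> = q ^ (Suc i ^ 2) * qpoch q (2 * N) * ((1 - q ^ (4 * N + 2)) * (1 - q ^ (4 * N + 4)))"
    proof -
      have "q ^ (4 * N) = v ^ 2 * w ^ 2" 
        by (simp add: m v_def w_def algebra_simps flip: power_mult power_add)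
      then show ?thesis unfolding sq1 P_def power_add by (simp add: algebra_simps)
    qed
    finally show ?thesis unfolding Q2 Q_def Suc by (simp add: mult.assoc)
  qed
qed

section \<open>The heat equation\<close>

lemma qpoch_nth_0: "fps_nth (qpoch fps_X n :: real fps) 0 = 1"
  by (induction n) (simp_all add: qpoch_def)

lemma odd_qpoch_sq_nth_0: "fps_nth (odd_qpoch_sq fps_X n :: real fps) 0 = 1"
  by (induction n) (simp_all add: odd_qpoch_sq_def power2_eq_square)

text \<open>
  Quotient of two neighbouring instances of the finite triple product. The factors that depend on
  \<open>N\<close> are \<open>1\<close> up to high order, which is all that passage to the limit needs.
\<close>
lemma theta_coeff_ratio:
  assumes "j < N"
  shows "(1 - fps_X ^ (2 * (N + j) + 2)) * theta_coeff x_odd N (Suc j) =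
         fps_X ^ (2 * j + 1) * ((1 - fps_X ^ (2 * (N - j))) * theta_coeff x_odd N j)"
proof -
  define c where "c = theta_coeff x_odd N"
  define W :: "real fps" where "W = odd_qpoch_sq fps_X N"
  define Q :: "nat \<Rightarrow> real fps" where "Q = qpoch fps_X"
  have J: "W * c i * (Q (N - i) * Q (N + i)) = fps_X ^ (i ^ 2) * Q (2 * N)" if "i \<le> N" for i
    unfolding W_def c_def Q_def using that by (intro finite_jacobi) (simp_all add: x_odd_def x_term_eq del: power_Suc)
  define Z where "Z = W * (Q (N - Suc j) * Q (N + j))"
  have "fps_nth Z 0 = 1"
    by (simp add: Z_def W_def Q_def qpoch_nth_0 odd_qpoch_sq_nth_0)
  then have "Z \<noteq> 0" by auto
  have "Suc j ^ 2 = 2 * j + 1 + j ^ 2" by (simp add: power2_eq_square)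
  have "Z * ((1 - fps_X ^ (2 * (N + j) + 2)) * c (Suc j)) = W * c (Suc j) * (Q (N - Suc j) * Q (Suc (N + j)))"
    by (simp only: Z_def Q_def qpoch_Suc ac_simps)
  also have "\<dots> = fps_X ^ (Suc j ^ 2) * Q (2 * N)" using J[of "Suc j"] assms by simp
  also have "\<dots> = fps_X ^ (2 * j + 1) * (fps_X ^ (j ^ 2) * Q (2 * N))"
    unfolding \<open>Suc j ^ 2 = _\<close> power_add by (simp only: ac_simps)
  also have "\<dots> = fps_X ^ (2 * j + 1) * (W * c j * (Q (N - j) * Q (N + j)))"
    using J[of j] assms by simp
  also have "N - j = Suc (N - Suc j)" using assms by simp
  also have "Q (Suc (N - Suc j)) = Q (N - Suc j) * (1 - fps_X ^ (2 * (N - j)))"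
  proof -
    have "2 * (N - Suc j) + 2 = 2 * (N - j)" using assms by simp
    then show ?thesis by (simp only: Q_def qpoch_Suc)
  qed
  finally have "Z * ((1 - fps_X ^ (2 * (N + j) + 2)) * c (Suc j)) =
      Z * (fps_X ^ (2 * j + 1) * ((1 - fps_X ^ (2 * (N - j))) * c j))"
    by (simp only: Z_def ac_simps)
  with \<open>Z \<noteq> 0\<close> show ?thesis by (simp add: c_def)
qed

text \<open>
  The \<open>q\<close>-adic limit of the coefficients as the number of variables grows. The sum can stop at
  \<open>k = n\<close> because the coefficient of \<open>q^n\<close> in the \<open>k\<close>-th generating function vanishes for \<open>k > n\<close>.
\<close>
definition theta_coeff_lim :: "nat \<Rightarrow> real fps" where
  "theta_coeff_lim j = Abs_fps (\<lambda>n. \<Sum>k\<le>n. real (central_choose k j) * M2 k n)"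

lemma theta_coeff_lim_nth: 
  assumes "n \<le> N"
  shows "fps_nth (theta_coeff_lim j) n = (\<Sum>k\<le>N. real (central_choose k j) * M2 k n)"
  unfolding theta_coeff_lim_def fps_nth_Abs_fps
  using assms by (intro sum.mono_neutral_left) (auto simp: M2_eq_0)

lemma theta_coeff_nth: 
  assumes "n \<le> N"
  shows "fps_nth (theta_coeff x_odd N j) n = fps_nth (theta_coeff_lim j) n"
  unfolding theta_coeff_lim_nth[OF assms] theta_coeff_def fps_sum_nth
  using assms by (simp add: M2_eq_esym[of n N] flip: fps_of_nat)

text \<open>
  In the limit only the factor \<open>q^(2j + 1)\<close> of the ratio survives: these are the coefficients of the
  theta series, whose exponents \<open>j^2\<close> increase by \<open>2j + 1\<close>.
\<close>
lemma theta_coeff_lim_Suc: "theta_coeff_lim (Suc j) = fps_X ^ (2 * j + 1) * theta_coeff_lim j"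
proof (rule fps_ext)
  fix n
  \<comment> \<open>large enough that the truncated factors are \<open>1\<close> up to order \<open>n\<close>\<close>
  define N where "N = n + j + 1"
  have "fps_nth (theta_coeff_lim (Suc j)) n =
      fps_nth ((1 - fps_X ^ (2 * (N + j) + 2)) * theta_coeff x_odd N (Suc j)) n"
    by (simp only: left_diff_distrib mult_1_left fps_sub_nth fps_X_power_mult_nth theta_coeff_nth)
       (simp add: N_def theta_coeff_nth)
  also have "\<dots> = fps_nth (fps_X ^ (2 * j + 1) * ((1 - fps_X ^ (2 * (N - j))) * theta_coeff x_odd N j)) n"
    by (subst theta_coeff_ratio) (auto simp: N_def)
  also have "\<dots> = fps_nth (fps_X ^ (2 * j + 1) * theta_coeff_lim j) n"
    by (simp only: left_diff_distrib mult_1_left fps_sub_nth fps_X_power_mult_nth)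
       (simp add: N_def theta_coeff_nth; arith)
  finally show "fps_nth (theta_coeff_lim (Suc j)) n = fps_nth (fps_X ^ (2 * j + 1) * theta_coeff_lim j) n" .
qed

definition euler_deriv :: "real fps \<Rightarrow> real fps" where
  "euler_deriv f = fps_X * fps_deriv f"

lemma euler_deriv_nth [simp]: "fps_nth (euler_deriv f) n = real n * fps_nth f n"
  by (cases n) (simp_all add: euler_deriv_def)

lemma euler_deriv_mult: "euler_deriv (f * g) = euler_deriv f * g + f * euler_deriv g"
  by (simp add: euler_deriv_def algebra_simps)

lemma euler_deriv_add: "euler_deriv (f + g) = euler_deriv f + euler_deriv g"
  by (simp add: euler_deriv_def algebra_simps)

lemma euler_deriv_diff: "euler_deriv (f - g) = euler_deriv f - euler_deriv g"
  by (simp add: euler_deriv_def algebra_simps)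

lemma euler_deriv_numeral: "euler_deriv (numeral a) = 0"
  by (simp add: euler_deriv_def)

lemma euler_deriv_1: "euler_deriv 1 = 0"
  by (simp add: euler_deriv_def)

lemma euler_deriv_X_power: "euler_deriv (fps_X ^ p) = of_nat p * fps_X ^ p"
  by (rule fps_ext) (simp flip: fps_of_nat)

lemma theta_coeff_lim_eq: "theta_coeff_lim j = fps_X ^ (j ^ 2) * theta_coeff_lim 0"
proof (induction j)
  case (Suc j)
  have "Suc j ^ 2 = (2 * j + 1) + j ^ 2" by (simp add: power2_eq_square)
  then show ?case unfolding theta_coeff_lim_Suc[of j] by (subst Suc.IH) (simp only: power_add ac_simps)
qed simp

text \<open>
  All coefficients are \<open>q^(j^2)\<close> times the same unit, and \<open>L\<close> is the logarithmic derivative of that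
  unit. The eigenvalue \<open>j^2\<close> is what \<open>(x d/dx)^2\<close> produces on \<open>x^j\<close>: this is the heat equation of
  the theta series.
\<close>
lemma euler_deriv_theta_coeff_lim:
  obtains L where "\<And>j. euler_deriv (theta_coeff_lim j) = (of_nat (j ^ 2) + L) * theta_coeff_lim j"
proof
  define L where "L = euler_deriv (theta_coeff_lim 0) * inverse (theta_coeff_lim 0)"
  fix j
  have "fps_nth (theta_coeff_lim 0) 0 = 1" by (simp add: theta_coeff_lim_def M2_0)
  then have "euler_deriv (theta_coeff_lim 0) = L * theta_coeff_lim 0"
    by (simp add: L_def mult.assoc inverse_mult_eq_1)
  then show "euler_deriv (theta_coeff_lim j) = (of_nat (j ^ 2) + L) * theta_coeff_lim j"
    unfolding theta_coeff_lim_eq[of j] euler_deriv_mult euler_deriv_X_power by (simp add: algebra_simps)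
qed

text \<open>
  The matrix \<open>central_choose k j\<close> is triangular with ones on the diagonal.
\<close>
lemma central_choose_triangular:
  fixes a :: "nat \<Rightarrow> real"
  assumes "\<And>j. (\<Sum>k\<le>n. real (central_choose k j) * a k) = 0" and "j \<le> n"
  shows "a j = 0"
  using \<open>j \<le> n\<close>
proof (induction "n - j" arbitrary: j rule: less_induct)
  case less
  have "(\<Sum>k\<le>n. real (central_choose k j) * a k) = (\<Sum>k\<in>{j}. real (central_choose k j) * a k)"
  proof (intro sum.mono_neutral_right ballI)
    fix k assume k: "k \<in> {..n} - {j}"
    show "real (central_choose k j) * a k = 0"
    proof (cases "k < j")
      case False
      with k less show ?thesis by auto
    qed (simp add: central_choose_eq_0)
  qed (use less in auto)
  then show ?case using assms(1)[of j] by simp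
qed

lemma M2_gf_nth: "fps_nth (M2_gf k) n = M2 k n" by (simp add: M2_def)

text \<open>
  Both sides of the heat equation for the limit coefficients are combinations of the generating
  functions with weights \<open>central_choose k j\<close>, once \<open>j^2\<close> has been moved onto \<open>k\<close> by the absorption rule.
  Triangularity then gives equality term by term.
\<close>
lemma M2_gf_heat:
  obtains L where "\<And>k. euler_deriv (M2_gf k) =
     L * M2_gf k + of_nat (k ^ 2) * M2_gf k - of_nat ((2 * k + 2) * (2 * k + 1)) * M2_gf (Suc k)"
proof -
  obtain L where L: "\<And>j. euler_deriv (theta_coeff_lim j) = (of_nat (j ^ 2) + L) * theta_coeff_lim j"
    using euler_deriv_theta_coeff_lim by blast
  define g where "g = (\<lambda>n k. real n * M2 k n - fps_nth (L * M2_gf k) n - real (k ^ 2) * M2 k n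
      + real ((2 * k + 2) * (2 * k + 1)) * M2 (Suc k) n)"
  \<comment> \<open>\<open>g n k\<close> is the coefficient of \<open>q^n\<close> in the difference of the two sides.\<close>
  have g0: "g n k = 0" for n k
  proof (cases "k \<le> n")
    case True
    show ?thesis
    proof (rule central_choose_triangular[OF _ True])
      fix j
      have 1: "fps_nth (L * theta_coeff_lim j) n = (\<Sum>k\<le>n. real (central_choose k j) * fps_nth (L * M2_gf k) n)"
      proof -
        have "fps_nth (L * theta_coeff_lim j) n = (\<Sum>i=0..n. \<Sum>k\<le>n. fps_nth L i * (real (central_choose k j) * M2 k (n - i)))"
          by (simp add: fps_mult_nth theta_coeff_lim_nth[of _ n] sum_distrib_left)
        also have "\<dots> = (\<Sum>k\<le>n. \<Sum>i=0..n. fps_nth L i * (real (central_choose k j) * M2 k (n - i)))"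
          by (rule sum.swap)
        finally show ?thesis by (simp add: fps_mult_nth M2_gf_nth sum_distrib_left mult_ac)
      qed
      have 2: "real (j ^ 2) * (\<Sum>k\<le>n. real (central_choose k j) * M2 k n) =
        (\<Sum>k\<le>n. real (central_choose k j) * (real (k ^ 2) * M2 k n - real ((2 * k + 2) * (2 * k + 1)) * M2 (Suc k) n))"
      proof -
        have ab: "real (j ^ 2) * real (central_choose (Suc k) j) =
            real (Suc k ^ 2) * real (central_choose (Suc k) j) - real ((2 * k + 2) * (2 * k + 1)) * real (central_choose k j)" for k
          using arg_cong[OF central_choose_absorb[of j k], of real] unfolding of_nat_add of_nat_mult
          by simp
        have "real (j ^ 2) * (\<Sum>k\<le>n. real (central_choose k j) * M2 k n) =
            (\<Sum>k<n. (real (j ^ 2) * real (central_choose (Suc k) j)) * M2 (Suc k) n)"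
          by (simp add: sum.atMost_shift central_choose_0_left sum_distrib_left mult.assoc)
        also have "\<dots> = (\<Sum>k<n. real (central_choose (Suc k) j) * (real (Suc k ^ 2) * M2 (Suc k) n)) - 
            (\<Sum>k<n. real (central_choose k j) * (real ((2 * k + 2) * (2 * k + 1)) * M2 (Suc k) n))"
          unfolding ab left_diff_distrib sum_subtractf by (simp only: mult_ac)
        also have "(\<Sum>k<n. real (central_choose (Suc k) j) * (real (Suc k ^ 2) * M2 (Suc k) n)) =
            (\<Sum>k\<le>n. real (central_choose k j) * (real (k ^ 2) * M2 k n))"
          by (simp add: sum.atMost_shift)
        also have "(\<Sum>k<n. real (central_choose k j) * (real ((2 * k + 2) * (2 * k + 1)) * M2 (Suc k) n)) =
            (\<Sum>k\<le>n. real (central_choose k j) * (real ((2 * k + 2) * (2 * k + 1)) * M2 (Suc k) n))"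
          by (simp add: M2_eq_0 flip: lessThan_Suc_atMost)
        finally show ?thesis by (simp add: right_diff_distrib sum_subtractf)
      qed
      have "real n * (\<Sum>k\<le>n. real (central_choose k j) * M2 k n) = real (j ^ 2) * (\<Sum>k\<le>n. real (central_choose k j) * M2 k n)
         + (\<Sum>k\<le>n. real (central_choose k j) * fps_nth (L * M2_gf k) n)"
        using arg_cong[OF L[of j], of "\<lambda>f. fps_nth f n"]
        unfolding 1[symmetric]
        by (simp add: distrib_right theta_coeff_lim_nth[OF order_refl] flip: fps_of_nat)
      then show "(\<Sum>k\<le>n. real (central_choose k j) * g n k) = 0"
        unfolding 2 g_def
        by (simp add: algebra_simps sum.distrib sum_subtractf sum_distrib_left)
    qed
  next
    case False
    then show ?thesis by (simp add: g_def M2_eq_0 fps_mult_nth M2_gf_nth)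
  qed
  show thesis
  proof
    fix k
    show "euler_deriv (M2_gf k) =
     L * M2_gf k + of_nat (k ^ 2) * M2_gf k - of_nat ((2 * k + 2) * (2 * k + 1)) * M2_gf (Suc k)"
    proof (rule fps_ext)
      fix n
      show "fps_nth (euler_deriv (M2_gf k)) n = fps_nth (L * M2_gf k + of_nat (k ^ 2) * M2_gf k - of_nat ((2 * k + 2) * (2 * k + 1)) * M2_gf (Suc k)) n"
        using g0[of n k] unfolding g_def
        by (simp only: euler_deriv_nth fps_add_nth fps_sub_nth fps_of_nat[symmetric] fps_mult_left_const_nth M2_gf_nth)
    qed
  qed
qed

lemma M2_gf_0: "M2_gf 0 = 1"
  by (rule fps_ext) (simp add: M2_gf_nth M2_0)

text \<open>
  For \<open>k = 0\<close> the left-hand side vanishes, which identifies \<open>L\<close> as twice the first generating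
  function.
\<close>
lemma M2_gf_recurrence:
  "euler_deriv (M2_gf k) = 2 * M2_gf 1 * M2_gf k + of_nat (k ^ 2) * M2_gf k
     - of_nat ((2 * k + 2) * (2 * k + 1)) * M2_gf (Suc k)"
proof -
  obtain L where L: "\<And>k. euler_deriv (M2_gf k) =
     L * M2_gf k + of_nat (k ^ 2) * M2_gf k - of_nat ((2 * k + 2) * (2 * k + 1)) * M2_gf (Suc k)"
    using M2_gf_heat by blast
  have "L = 2 * M2_gf 1" using L[of 0] by (simp add: M2_gf_0 euler_deriv_1)
  then show ?thesis using L by simp
qed

section \<open>Divisor sums as polynomials in the generating functions\<close>

text \<open>
  The power series \<open>\<Sum>j. j^r t^j\<close> over \<open>j \<ge> 1\<close>. The case distinction matters only for \<open>r = 0\<close>,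
  where it gives \<open>t / (1 - t)\<close> instead of \<open>1 / (1 - t)\<close>.
\<close>
definition power_fps :: "nat \<Rightarrow> real fps" where
  "power_fps r = Abs_fps (\<lambda>j. if j = 0 then 0 else real j ^ r)"

lemma euler_deriv_power_fps: "euler_deriv (power_fps r) = power_fps (Suc r)"
  by (rule fps_ext) (simp add: power_fps_def)

lemma power_fps_nth_0 [simp]: "fps_nth (power_fps r) 0 = 0"
  by (simp add: power_fps_def)

lemma power_fps_0_mult: "(1 - fps_X) * power_fps 0 = fps_X"
proof (rule fps_ext)
  fix n
  show "fps_nth ((1 - fps_X) * power_fps 0) n = fps_nth fps_X n"
    by (cases n) (auto simp: left_diff_distrib power_fps_def)
qed

text \<open>
  With \<open>g = t / (1 - t)\<close> this is \<open>t / (1 - t)^2 = g (1 + g)\<close>. It makes the Euler operator act on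
  polynomials in \<open>g\<close>, which is how the higher power series are computed.
\<close>
lemma power_fps_1_eq: "power_fps 1 = power_fps 0 + power_fps 0 ^ 2"
proof -
  have "euler_deriv ((1 - fps_X) * power_fps 0) = euler_deriv fps_X" by (simp only: power_fps_0_mult)
  then have "(1 - fps_X) * power_fps 1 = fps_X + fps_X * power_fps 0"
    by (simp add: euler_deriv_mult euler_deriv_power_fps) (simp add: euler_deriv_def algebra_simps)
  also have "\<dots> = (1 - fps_X) * (power_fps 0 + power_fps 0 ^ 2)"
    by (subst (1 2) power_fps_0_mult[symmetric]) (simp add: algebra_simps power2_eq_square)
  finally show ?thesis
    by (subst (asm) mult_cancel_left) (auto simp: fps_eq_iff split: if_splits)
qed

lemma power_fps_1_mult: "(1 - fps_X) ^ 2 * power_fps 1 = fps_X"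
proof -
  have "(1 - fps_X) ^ 2 * power_fps 1 = (1 - fps_X) * ((1 - fps_X) * power_fps 0) + ((1 - fps_X) * power_fps 0) ^ 2"
    unfolding power_fps_1_eq by (simp add: algebra_simps power2_eq_square)
  then show ?thesis unfolding power_fps_0_mult by (simp add: algebra_simps power2_eq_square)
qed

lemma power_fps_2_eq: "power_fps 2 = power_fps 1 + 2 * power_fps 0 * power_fps 1"
  using arg_cong[OF power_fps_1_eq, of euler_deriv]
  by (simp add: euler_deriv_power_fps euler_deriv_add euler_deriv_mult power2_eq_square numeral_2_eq_2)

text \<open>
  Since \<open>(1 + 2g)^2 = 1 + 4 g (1 + g)\<close>, two applications of the Euler operator turn a polynomial in
  \<open>g (1 + g)\<close> into such a polynomial again.
\<close>
lemma power_fps_3_eq: "power_fps 3 = 6 * power_fps 1 ^ 2 + power_fps 1"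
proof -
  have "power_fps 3 = power_fps 2 + 2 * power_fps 1 * power_fps 1 + 2 * power_fps 0 * power_fps 2"
    using arg_cong[OF power_fps_2_eq, of euler_deriv]
    by (simp add: euler_deriv_power_fps euler_deriv_add euler_deriv_mult euler_deriv_numeral
         numeral_2_eq_2 numeral_3_eq_3 algebra_simps)
  also have "\<dots> = power_fps 1 + 2 * power_fps 1 ^ 2 + 4 * (power_fps 0 + power_fps 0 ^ 2) * power_fps 1"
    unfolding power_fps_2_eq by (simp add: algebra_simps power2_eq_square)
  also have "\<dots> = 6 * power_fps 1 ^ 2 + power_fps 1"
    unfolding power_fps_1_eq[symmetric] by (simp add: algebra_simps power2_eq_square)
  finally show ?thesis .
qed

lemma power_fps_5_eq: "power_fps 5 = 120 * power_fps 1 ^ 3 + 30 * power_fps 1 ^ 2 + power_fps 1"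
proof -
  have 4: "power_fps 4 = 12 * power_fps 1 * power_fps 2 + power_fps 2"
    using arg_cong[OF power_fps_3_eq, of euler_deriv]
    by (simp add: euler_deriv_power_fps euler_deriv_add euler_deriv_mult euler_deriv_numeral
         numeral_eq_Suc algebra_simps)
  have "power_fps 5 = 12 * power_fps 2 ^ 2 + 12 * power_fps 1 * power_fps 3 + power_fps 3"
    using arg_cong[OF 4, of euler_deriv]
    by (simp add: euler_deriv_power_fps euler_deriv_add euler_deriv_mult euler_deriv_numeral
         numeral_eq_Suc algebra_simps)
  also have "power_fps 2 ^ 2 = power_fps 1 ^ 2 + 4 * (power_fps 0 + power_fps 0 ^ 2) * power_fps 1 ^ 2"
    unfolding power_fps_2_eq by (simp add: algebra_simps power2_eq_square)
  also have "\<dots> = power_fps 1 ^ 2 + 4 * power_fps 1 ^ 3"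
    unfolding power_fps_1_eq[symmetric] by (simp add: power2_eq_square power3_eq_cube)
  finally show ?thesis
    unfolding power_fps_3_eq by (simp add: algebra_simps power2_eq_square power3_eq_cube)
qed

lemma x_term_eq_power_fps: 
  assumes "m > 0"
  shows "x_term m = power_fps 1 oo fps_X ^ m"
proof -
  have X0: "fps_nth (fps_X ^ m :: real fps) 0 = 0" using assms by simp
  have "(1 - fps_X ^ m) ^ 2 * (power_fps 1 oo fps_X ^ m) = ((1 - fps_X) ^ 2 * power_fps 1) oo fps_X ^ m"
    by (simp add: fps_compose_mult_distrib[OF X0] fps_compose_power[OF X0, symmetric] fps_compose_sub_distrib
         fps_X_fps_compose_startby0[OF X0])
  also have "\<dots> = fps_X ^ m" unfolding power_fps_1_mult by (rule fps_X_fps_compose_startby0[OF X0])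
  also have "\<dots> = (1 - fps_X ^ m) ^ 2 * x_term m" using x_term_eq[OF assms] by simp
  finally have "(1 - fps_X ^ m) ^ 2 * (power_fps 1 oo fps_X ^ m) = (1 - fps_X ^ m) ^ 2 * x_term m" .
  moreover have "(1 - fps_X ^ m :: real fps) ^ 2 \<noteq> 0" using one_minus_X_power_unit[OF assms] by force
  ultimately show ?thesis by (simp only: mult_cancel_left) auto
qed

lemma power_fps_compose_nth:
  assumes "m > 0" "n > 0"
  shows "fps_nth (power_fps r oo fps_X ^ m) n = (if m dvd n then real (n div m) ^ r else 0)"
proof -
  have "fps_nth (power_fps r oo fps_X ^ m) n = (\<Sum>i=0..n. if n = m * i then fps_nth (power_fps r) i else 0)"
    by (simp add: fps_compose_nth if_distrib flip: power_mult cong: if_cong)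
  also have "\<dots> = (if m dvd n then real (n div m) ^ r else 0)"
  proof (cases "m dvd n")
    case True
    then have "(n = m * i) = (i = n div m)" for i using assms by auto
    moreover have "n div m \<noteq> 0" using True assms by auto
    ultimately show ?thesis using True by (simp add: power_fps_def)
  qed (auto intro!: sum.neutral)
  finally show ?thesis .
qed

text \<open>
  The sum of \<open>j^r\<close> over the divisors \<open>j\<close> of \<open>n\<close> with odd \<open>n / j\<close>. It is indexed by the complementary
  divisor, which is the odd number \<open>m\<close> of the term \<open>j^r q^(mj)\<close> in the expansions below.
\<close>
definition odd_codivisor_sum :: "nat \<Rightarrow> nat \<Rightarrow> real" where
  "odd_codivisor_sum r n = (\<Sum>d | d dvd n \<and> odd d. real (n div d) ^ r)"

definition odd_codivisor_gf :: "nat \<Rightarrow> real fps" where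
  "odd_codivisor_gf r = Abs_fps (\<lambda>n. if n = 0 then 0 else odd_codivisor_sum r n)"

lemma odd_codivisor_gf_nth:
  assumes "n \<le> N"
  shows "fps_nth (odd_codivisor_gf r) n = fps_nth (\<Sum>i<N. power_fps r oo fps_X ^ (2 * i + 1)) n"
proof (cases "n = 0")
  case False
  have "fps_nth (\<Sum>i<N. power_fps r oo fps_X ^ (2 * i + 1)) n =
      (\<Sum>i<N. if (2 * i + 1) dvd n then real (n div (2 * i + 1)) ^ r else 0)"
    unfolding fps_sum_nth using False by (intro sum.cong refl power_fps_compose_nth) auto
  also have "\<dots> = (\<Sum>i | i < N \<and> (2 * i + 1) dvd n. real (n div (2 * i + 1)) ^ r)"
    by (subst sum.inter_filter[symmetric]) (auto intro: sum.cong)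
  also have "\<dots> = odd_codivisor_sum r n"
    unfolding odd_codivisor_sum_def
  proof (rule sum.reindex_bij_witness[of _ "\<lambda>d. d div 2" "\<lambda>i. 2 * i + 1"])
    fix d assume d: "d \<in> {d. d dvd n \<and> odd d}"
    then have "d \<le> N" using dvd_imp_le[of d n] False assms by auto
    then show "d div 2 \<in> {i. i < N \<and> (2 * i + 1) dvd n}" using d by (auto elim!: oddE)
  qed (auto elim!: oddE)
  finally show ?thesis using False by (simp add: odd_codivisor_gf_def)
qed (simp add: odd_codivisor_gf_def fps_sum_nth)

text \<open>
  Agreement modulo \<open>q^(n + 1)\<close>. It is a congruence, so Newton's identities for the truncated
  elementary symmetric polynomials carry over to the generating functions.
\<close>
definition eq_upto :: "nat \<Rightarrow> real fps \<Rightarrow> real fps \<Rightarrow> bool" where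
  "eq_upto n f g \<longleftrightarrow> (\<forall>i\<le>n. fps_nth f i = fps_nth g i)"

lemma eq_upto_refl: "eq_upto n f f" by (simp add: eq_upto_def)

lemma eq_upto_add: "eq_upto n f f' \<Longrightarrow> eq_upto n g g' \<Longrightarrow> eq_upto n (f + g) (f' + g')"
  by (simp add: eq_upto_def)

lemma eq_upto_diff: "eq_upto n f f' \<Longrightarrow> eq_upto n g g' \<Longrightarrow> eq_upto n (f - g) (f' - g')"
  by (simp add: eq_upto_def)

lemma eq_upto_mult: "eq_upto n f f' \<Longrightarrow> eq_upto n g g' \<Longrightarrow> eq_upto n (f * g) (f' * g')"
  by (simp add: eq_upto_def fps_mult_nth)

lemma eq_upto_power: "eq_upto n f f' \<Longrightarrow> eq_upto n (f ^ k) (f' ^ k)"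
  by (induction k) (auto intro: eq_upto_refl eq_upto_mult)

lemma eq_upto_esym: "eq_upto n (esym x_odd n k) (M2_gf k)"
  by (simp add: eq_upto_def M2_gf_nth M2_eq_esym[of _ n])

lemmas eq_upto_intros = eq_upto_refl eq_upto_add eq_upto_diff eq_upto_mult eq_upto_power eq_upto_esym

lemma eq_upto_odd_codivisor_gf: "eq_upto n (odd_codivisor_gf r) (\<Sum>i<n. power_fps r oo fps_X ^ (2 * i + 1))"
  by (simp add: eq_upto_def odd_codivisor_gf_nth[of _ n])

lemma fps_eqI_upto:
  assumes "\<And>n. \<exists>h. eq_upto n f h \<and> eq_upto n h g"
  shows "f = g"
  using assms by (metis eq_upto_def fps_ext order_refl)

lemma esym_1_eq_sum: "esym x N 1 = (\<Sum>i<N. x i)"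
  by (induction N) simp_all

text \<open>
  Summing \<open>j^r q^(mj)\<close> over odd \<open>m\<close> expresses the divisor sums through power sums of the
  \<open>q^m / (1 - q^m)^2\<close>, and Newton's identities express those through the generating functions.
\<close>
lemma odd_codivisor_gf_1: "odd_codivisor_gf 1 = M2_gf 1"
proof (rule fps_eqI_upto)
  fix n
  have "(\<Sum>i<n. power_fps 1 oo fps_X ^ (2 * i + 1)) = esym x_odd n 1"
    unfolding esym_1_eq_sum x_odd_def by (simp add: x_term_eq_power_fps)
  then show "\<exists>h. eq_upto n (odd_codivisor_gf 1) h \<and> eq_upto n h (M2_gf 1)"
    using eq_upto_odd_codivisor_gf[of n 1] eq_upto_esym[of n 1] by auto
qed

lemma odd_codivisor_gf_3: "odd_codivisor_gf 3 = 6 * (M2_gf 1 ^ 2 - 2 * M2_gf 2) + M2_gf 1"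
proof (rule fps_eqI_upto)
  fix n
  have "power_fps 3 oo fps_X ^ (2 * i + 1) = 6 * x_odd i ^ 2 + x_odd i" for i
  proof -
    have X0: "fps_nth (fps_X ^ (2 * i + 1) :: real fps) 0 = 0" by simp
    show ?thesis unfolding power_fps_3_eq x_odd_def
      by (simp only: fps_compose_add_distrib fps_compose_mult_distrib[OF X0] fps_compose_power[OF X0, symmetric]
          numeral_compose x_term_eq_power_fps zero_less_Suc add_gr_0 zero_less_one simp_thms)
  qed
  then have "(\<Sum>i<n. power_fps 3 oo fps_X ^ (2 * i + 1)) = 6 * (\<Sum>i<n. x_odd i ^ 2) + (\<Sum>i<n. x_odd i)"
    by (simp add: sum.distrib sum_distrib_left)
  also have "\<dots> = 6 * (esym x_odd n 1 ^ 2 - 2 * esym x_odd n 2) + esym x_odd n 1"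
    by (simp only: power_sum_2_esym esym_1_eq_sum)
  finally show "\<exists>h. eq_upto n (odd_codivisor_gf 3) h \<and> eq_upto n h (6 * (M2_gf 1 ^ 2 - 2 * M2_gf 2) + M2_gf 1)"
    using eq_upto_odd_codivisor_gf[of n 3] by (auto intro!: exI[of _ "\<Sum>i<n. power_fps 3 oo fps_X ^ (2 * i + 1)"] eq_upto_intros)
qed

lemma odd_codivisor_gf_5: "odd_codivisor_gf 5 = 120 * (M2_gf 1 ^ 3 - 3 * M2_gf 1 * M2_gf 2 + 3 * M2_gf 3)
    + 30 * (M2_gf 1 ^ 2 - 2 * M2_gf 2) + M2_gf 1"
proof (rule fps_eqI_upto)
  fix n
  have "power_fps 5 oo fps_X ^ (2 * i + 1) = 120 * x_odd i ^ 3 + 30 * x_odd i ^ 2 + x_odd i" for i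
  proof -
    have X0: "fps_nth (fps_X ^ (2 * i + 1) :: real fps) 0 = 0" by simp
    show ?thesis unfolding power_fps_5_eq x_odd_def
      by (simp only: fps_compose_add_distrib fps_compose_mult_distrib[OF X0] fps_compose_power[OF X0, symmetric]
          numeral_compose x_term_eq_power_fps zero_less_Suc add_gr_0 zero_less_one simp_thms)
  qed
  then have "(\<Sum>i<n. power_fps 5 oo fps_X ^ (2 * i + 1)) =
      120 * (\<Sum>i<n. x_odd i ^ 3) + 30 * (\<Sum>i<n. x_odd i ^ 2) + (\<Sum>i<n. x_odd i)"
    by (simp add: sum.distrib sum_distrib_left)
  also have "\<dots> = 120 * (esym x_odd n 1 ^ 3 - 3 * esym x_odd n 1 * esym x_odd n 2 + 3 * esym x_odd n 3)
      + 30 * (esym x_odd n 1 ^ 2 - 2 * esym x_odd n 2) + esym x_odd n 1"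
    by (simp only: power_sum_2_esym power_sum_3_esym esym_1_eq_sum)
  finally show "\<exists>h. eq_upto n (odd_codivisor_gf 5) h \<and> eq_upto n h (120 * (M2_gf 1 ^ 3 - 3 * M2_gf 1 * M2_gf 2 + 3 * M2_gf 3)
    + 30 * (M2_gf 1 ^ 2 - 2 * M2_gf 2) + M2_gf 1)"
    using eq_upto_odd_codivisor_gf[of n 5] by (auto intro!: exI[of _ "\<Sum>i<n. power_fps 5 oo fps_X ^ (2 * i + 1)"] eq_upto_intros)
qed

section \<open>The two linear relations\<close>

lemma euler_deriv_M2_gf_1: 
  "euler_deriv (M2_gf 1) = 2 * M2_gf 1 ^ 2 + M2_gf 1 - 12 * M2_gf 2"
  using M2_gf_recurrence[of 1] by (simp add: power2_eq_square numeral_2_eq_2[symmetric] mult.assoc)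

lemma euler_deriv_M2_gf_2: 
  "euler_deriv (M2_gf 2) = 2 * M2_gf 1 * M2_gf 2 + 4 * M2_gf 2 - 30 * M2_gf 3"
  using M2_gf_recurrence[of 2] by (simp add: numeral_3_eq_3[symmetric])

lemma odd_codivisor_gf_3_eq_M2: "3 * euler_deriv (M2_gf 1) = 2 * M2_gf 1 - 24 * M2_gf 2 + odd_codivisor_gf 3"
  unfolding euler_deriv_M2_gf_1 odd_codivisor_gf_3 by (simp add: algebra_simps)

text \<open>
  The recurrences express all derivatives as polynomials in the first three generating functions.
  The cubic polynomial in the divisor series involves the same nonlinear terms, and in this
  combination they cancel.
\<close>
lemma odd_codivisor_gf_5_eq_M2:
  "15 * euler_deriv (euler_deriv (M2_gf 1)) + 360 * euler_deriv (M2_gf 2) =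
    30 * euler_deriv (M2_gf 1) - 16 * M2_gf 1 + 960 * M2_gf 2 - 5760 * M2_gf 3 + odd_codivisor_gf 5"
proof -
  define e1 e2 e3 where "e1 = M2_gf 1" and "e2 = M2_gf 2" and "e3 = M2_gf 3"
  have 1: "euler_deriv e1 = 2 * e1 ^ 2 + e1 - 12 * e2"
    unfolding e1_def e2_def by (rule euler_deriv_M2_gf_1)
  have 2: "euler_deriv e2 = 2 * e1 * e2 + 4 * e2 - 30 * e3"
    unfolding e1_def e2_def e3_def by (rule euler_deriv_M2_gf_2)
  have "euler_deriv (euler_deriv e1) = 4 * e1 * euler_deriv e1 + euler_deriv e1 - 12 * euler_deriv e2"
    by (subst 1) (simp add: euler_deriv_add euler_deriv_diff euler_deriv_mult euler_deriv_numeral power2_eq_square)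
  also have "\<dots> = 8 * e1 ^ 3 + 6 * e1 ^ 2 + e1 - 72 * e1 * e2 - 60 * e2 + 360 * e3"
    unfolding 1 2 by (simp add: algebra_simps power2_eq_square power3_eq_cube)
  finally have 3: "euler_deriv (euler_deriv e1) =
    8 * e1 ^ 3 + 6 * e1 ^ 2 + e1 - 72 * e1 * e2 - 60 * e2 + 360 * e3" .
  show ?thesis
    unfolding odd_codivisor_gf_5 e1_def[symmetric] e2_def[symmetric] e3_def[symmetric] 3
    unfolding 1 2 by (simp add: algebra_simps power2_eq_square power3_eq_cube)
qed

text \<open>
  On coefficients the Euler operator is multiplication by \<open>n\<close>, so the relations between series
  become linear relations with polynomial coefficients. After multiplication by \<open>n + 1\<close> the
  factors \<open>n^2 - n + 1\<close> and \<open>n^4 - n^3 + n^2 - n + 1\<close> become \<open>n^3 + 1\<close> and \<open>n^5 + 1\<close>.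
\<close>
lemma M2_quadratic_combination:
  assumes "n > 0"
  shows "(real n ^ 2 - 4 * real n + 3) * M2 1 n - 24 * M2 2 n =
    (real n ^ 2 - real n + 1) * odd_codivisor_sum 1 n - odd_codivisor_sum 3 n"
proof -
  have 1: "M2 1 n = odd_codivisor_sum 1 n"
    using arg_cong[OF odd_codivisor_gf_1, of "\<lambda>f. fps_nth f n"] assms by (simp add: odd_codivisor_gf_def M2_gf_nth)
  have "3 * (real n * M2 1 n) = 2 * M2 1 n - 24 * M2 2 n + odd_codivisor_sum 3 n"
    using arg_cong[OF odd_codivisor_gf_3_eq_M2, of "\<lambda>f. fps_nth f n"] assms
    by (simp add: odd_codivisor_gf_def M2_gf_nth numeral_fps_const)
  then show ?thesis unfolding 1[symmetric] by (simp add: algebra_simps)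
qed

lemma M2_quartic_combination:
  assumes "n > 0"
  shows "(real n ^ 4 - real n ^ 3 - 14 * real n ^ 2 + 29 * real n - 15) * M2 1 n
              - 120 * (3 * real n - 8) * M2 2 n - 5760 * M2 3 n =
    (real n ^ 4 - real n ^ 3 + real n ^ 2 - real n + 1) * odd_codivisor_sum 1 n - odd_codivisor_sum 5 n"
proof -
  have 1: "M2 1 n = odd_codivisor_sum 1 n"
    using arg_cong[OF odd_codivisor_gf_1, of "\<lambda>f. fps_nth f n"] assms by (simp add: odd_codivisor_gf_def M2_gf_nth)
  have "15 * (real n * (real n * M2 1 n)) + 360 * (real n * M2 2 n) =
    30 * (real n * M2 1 n) - 16 * M2 1 n + 960 * M2 2 n - 5760 * M2 3 n + odd_codivisor_sum 5 n"
    using arg_cong[OF odd_codivisor_gf_5_eq_M2, of "\<lambda>f. fps_nth f n"] assms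
    by (simp add: odd_codivisor_gf_def M2_gf_nth numeral_fps_const)
  then show ?thesis unfolding 1[symmetric] by (simp add: algebra_simps power2_eq_square)
qed

section \<open>Sign analysis\<close>

text \<open>
  The contribution of a divisor \<open>j \<le> n / 3\<close>. It is dominated by \<open>j n^(k + 1)\<close>, because
  \<open>(n + 1) (n / 3)^k\<close> is at most \<open>2/9\<close> of \<open>n^(k + 1)\<close>. So \<open>j \<ge> 2\<close> already outweighs the negative
  contribution \<open>- n (n^k - 1)\<close> of the divisor \<open>n\<close>.
\<close>
lemma odd_divisor_terms:
  fixes n k :: nat
  defines "h \<equiv> \<lambda>j. real j * (real n ^ (k + 1) + 1 - (real n + 1) * real j ^ k)"
  assumes "k \<ge> 2" "j > 0" "3 * j \<le> n"
  shows "h j > 0" and "j \<ge> 2 \<Longrightarrow> h j > real n * (real n ^ k - 1)"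
proof -
  have n: "real n \<ge> 3" using assms by linarith
  have "(3 * real j) ^ k \<le> real n ^ k" using assms by (intro power_mono) auto
  moreover have "(3::real) ^ 2 \<le> 3 ^ k" using assms by (intro power_increasing) auto
  ultimately have "9 * real j ^ k \<le> real n ^ k"
    using mult_right_mono[of "3 ^ 2" "3 ^ k" "real j ^ k"] by (simp add: power_mult_distrib)
  then have "(real n + 1) * (9 * real j ^ k) \<le> (2 * real n) * real n ^ k"
    using n by (intro mult_mono) auto
  then have *: "9 * ((real n + 1) * real j ^ k) \<le> 2 * real n ^ (k + 1)" by (simp add: algebra_simps)
  have pos: "real n ^ (k + 1) > 0" using n by simp
  define g where "g = real n ^ (k + 1) + 1 - (real n + 1) * real j ^ k"
  have g: "g > 7 / 9 * real n ^ (k + 1)" using * unfolding g_def by linarith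
  have h: "h j = real j * g" by (simp add: h_def g_def)
  show "h j > 0" unfolding h using g pos \<open>j > 0\<close> by (intro mult_pos_pos) (auto simp: field_simps)
  show "h j > real n * (real n ^ k - 1)" if "j \<ge> 2"
  proof -
    have "real n * (real n ^ k - 1) < real n ^ (k + 1)" using n by (simp add: algebra_simps)
    also have "\<dots> < 2 * g" using g pos by linarith
    also have "\<dots> \<le> h j" unfolding h using that g pos by (intro mult_right_mono) auto
    finally show ?thesis .
  qed
qed

text \<open>
  Times \<open>n + 1\<close>, the expression is the sum of \<open>j (n^(k+1) + 1 - (n + 1) j^k)\<close> over the divisors \<open>j\<close>
  of \<open>n\<close> with odd \<open>n / j\<close>. The terms at \<open>j = n\<close> and \<open>j = 1\<close> are opposite, the first one being
  negative, and all others are positive. An odd prime has exactly these two terms, and a power of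
  two only has \<open>j = n\<close>. An odd composite \<open>n\<close> has both terms and at least one more. Any other even \<open>n\<close>
  has the negative term and a term with even \<open>j\<close>, which is larger in absolute value.
\<close>
lemma sign_trichotomy:
  fixes n k :: nat and Q :: real
  assumes n: "n \<ge> 2" and k: "k \<ge> 2" and Q: "(real n + 1) * Q = real n ^ (k + 1) + 1"
  defines "E \<equiv> Q * odd_codivisor_sum 1 n - odd_codivisor_sum (k + 1) n"
  shows "prime n \<and> odd n \<Longrightarrow> E = 0"
    and "\<exists>l::nat. l \<ge> 1 \<and> n = 2 ^ l \<Longrightarrow> E < 0"
    and "\<not> (prime n \<and> odd n) \<Longrightarrow> \<not> (\<exists>l::nat. l \<ge> 1 \<and> n = 2 ^ l) \<Longrightarrow> E > 0"
proof -
  define h where "h = (\<lambda>j::nat. real j * (real n ^ (k + 1) + 1 - (real n + 1) * real j ^ k))"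
  define A where "A = {d. d dvd n \<and> odd d}"
  have fin: "finite A" unfolding A_def using n by simp
  have E: "(real n + 1) * E = (\<Sum>d\<in>A. h (n div d))"
  proof -
    have "(real n + 1) * E =
        (\<Sum>d\<in>A. (real n + 1) * Q * real (n div d) - (real n + 1) * real (n div d) ^ (k + 1))"
      by (simp add: E_def odd_codivisor_sum_def A_def sum_distrib_left sum_subtractf
          right_diff_distrib mult.assoc)
    also have "\<dots> = (\<Sum>d\<in>A. h (n div d))"
      unfolding Q h_def by (intro sum.cong refl) (simp add: algebra_simps)
    finally show ?thesis .
  qed
  have h1: "h 1 = real n * (real n ^ k - 1)" and hn: "h n = - (real n * (real n ^ k - 1))"
    by (simp_all add: h_def algebra_simps)
  have h1_pos: "h 1 > 0" unfolding h1 using n k by (intro mult_pos_pos) auto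
  have pos_iff: "E = 0 \<longleftrightarrow> (\<Sum>d\<in>A. h (n div d)) = 0" "E < 0 \<longleftrightarrow> (\<Sum>d\<in>A. h (n div d)) < 0"
     "E > 0 \<longleftrightarrow> (\<Sum>d\<in>A. h (n div d)) > 0"
    unfolding E[symmetric] by (auto simp: mult_less_0_iff zero_less_mult_iff)
  have one: "1 \<in> A" by (simp add: A_def)
  show "E = 0" if p: "prime n \<and> odd n"
  proof -
    have "A = {1, n}" using p by (auto simp: A_def prime_nat_iff)
    then show ?thesis unfolding pos_iff using n h1 hn by simp
  qed
  show "E < 0" if pow: "\<exists>l::nat. l \<ge> 1 \<and> n = 2 ^ l"
  proof -
    obtain l where l: "n = 2 ^ l" using pow by blast
    have "d = 1" if "d \<in> A" for d
    proof -
      have "d dvd 2 ^ l" "odd d" using that l by (auto simp: A_def)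
      then have "coprime d (2 ^ l)" by simp
      from coprime_common_divisor[OF this dvd_refl \<open>d dvd 2 ^ l\<close>] show ?thesis by simp
    qed
    then have "A = {1}" using one by blast
    then show ?thesis unfolding pos_iff using h1_pos h1 hn by simp
  qed
  show "E > 0" if np: "\<not> (prime n \<and> odd n)" and n2: "\<not> (\<exists>l::nat. l \<ge> 1 \<and> n = 2 ^ l)"
  proof -
    have small: "n div d > 0" "3 * (n div d) \<le> n" if "d \<in> A - {1}" for d
    proof -
      have "d dvd n" "odd d" "d \<noteq> 1" using that by (auto simp: A_def)
      have "d \<ge> 3" using \<open>odd d\<close> \<open>d \<noteq> 1\<close> by presburger
      obtain j where j: "n = d * j" using \<open>d dvd n\<close> by blast
      then have "j > 0" "d > 0" using n by (auto intro!: Nat.gr0I)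
      then show "n div d > 0" "3 * (n div d) \<le> n" using j \<open>d \<ge> 3\<close> by auto
    qed
    have h_pos: "h (n div d) > 0" if "d \<in> A - {1}" for d
      unfolding h_def using odd_divisor_terms(1)[OF k small[OF that]] .
    have excess: "(\<Sum>d\<in>A - {1}. h (n div d)) > h 1"
    proof (cases "odd n")
      case True
      then have "\<not> prime n" using np by simp
      then obtain d where d: "d dvd n" "d \<noteq> 1" "d \<noteq> n" using n by (auto simp: prime_nat_iff)
      have "odd d" using d(1) True dvd_trans by blast
      have "h (n div n) + h (n div d) = (\<Sum>d\<in>{n, d}. h (n div d))" using d by simp
      also have "\<dots> \<le> (\<Sum>d\<in>A - {1}. h (n div d))"
        using fin d True n \<open>odd d\<close> h_pos by (intro sum_mono2) (auto simp: A_def intro: less_imp_le)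
      finally have "h 1 + h (n div d) \<le> (\<Sum>d\<in>A - {1}. h (n div d))" using n by simp
      moreover have "h (n div d) > 0" using d \<open>odd d\<close> by (intro h_pos) (auto simp: A_def)
      ultimately show ?thesis by linarith
    next
      case False
      obtain m where m: "n = 2 ^ multiplicity 2 n * m" "odd m"
        using multiplicity_decompose'[of n 2] n by auto
      have "m \<noteq> 1"
      proof
        assume "m = 1"
        then have "n = 2 ^ multiplicity 2 n" using m by simp
        moreover have "multiplicity 2 n \<ge> 1"
          using False n by (intro multiplicity_geI) auto
        ultimately show False using n2 by blast
      qed
      have "m dvd n" using m(1) dvd_triv_right by metis
      then have mA: "m \<in> A - {1}" using m(2) \<open>m \<noteq> 1\<close> by (simp add: A_def)
      have "m * (n div m) = n" using mA by (auto simp: A_def)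
      then have "even (n div m)" using False m(2) by (metis even_mult_iff)
      then have "n div m \<ge> 2" using small[OF mA] by (auto elim!: evenE)
      then have "h 1 < h (n div m)"
        unfolding h1 using odd_divisor_terms(2)[OF k small[OF mA]] by (simp add: h_def)
      also have "\<dots> \<le> (\<Sum>d\<in>A - {1}. h (n div d))"
        using mA fin h_pos by (intro member_le_sum) (auto intro: less_imp_le)
      finally show ?thesis .
    qed
    have "(\<Sum>d\<in>A. h (n div d)) = h n + (\<Sum>d\<in>A - {1}. h (n div d))"
      using fin one by (simp add: sum.remove)
    then show ?thesis unfolding pos_iff using excess h1 hn by simp
  qed
qed

theorem theorem1p1:
  fixes n :: nat
  assumes "n \<ge> 2"
  shows
    "(let E = (real n ^ 2 - 4 * real n + 3) * M2 1 n - 24 * M2 2 n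
      in (prime n \<and> odd n \<longrightarrow> E = 0)
       \<and> ((\<exists>l::nat. l \<ge> 1 \<and> n = 2 ^ l) \<longrightarrow> E < 0)
       \<and> (\<not> (prime n \<and> odd n) \<and> \<not> (\<exists>l::nat. l \<ge> 1 \<and> n = 2 ^ l) \<longrightarrow> E > 0))
   \<and> (let E = (real n ^ 4 - real n ^ 3 - 14 * real n ^ 2 + 29 * real n - 15) * M2 1 n
              - 120 * (3 * real n - 8) * M2 2 n - 5760 * M2 3 n
      in (prime n \<and> odd n \<longrightarrow> E = 0)
       \<and> ((\<exists>l::nat. l \<ge> 1 \<and> n = 2 ^ l) \<longrightarrow> E < 0)
       \<and> (\<not> (prime n \<and> odd n) \<and> \<not> (\<exists>l::nat. l \<ge> 1 \<and> n = 2 ^ l) \<longrightarrow> E > 0))"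
proof -
  have n: "n > 0" using assms by simp
  have Q1: "(real n + 1) * (real n ^ 2 - real n + 1) = real n ^ (2 + 1) + 1"
    by (simp add: algebra_simps power2_eq_square)
  have Q2: "(real n + 1) * (real n ^ 4 - real n ^ 3 + real n ^ 2 - real n + 1) = real n ^ (4 + 1) + 1"
    by (simp add: algebra_simps numeral_eq_Suc)
  have eqs: "(2::nat) + 1 = 3" "(4::nat) + 1 = 5" by simp_all
  show ?thesis
    unfolding Let_def M2_quadratic_combination[OF n] M2_quartic_combination[OF n]
    using sign_trichotomy[OF assms _ Q1] sign_trichotomy[OF assms _ Q2]
    unfolding eqs by simp
qed

end
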